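(* Let $\alpha_0,\alpha_1,\alpha_2,\alpha_3,\alpha_4\in\mathbb C$ satisfy $\alpha_0+\alpha_1+2\alpha_2+\alpha_3+\alpha_4=1$. Suppose that a system of the form $(S)$ (see context), with coefficients $a_1,\dots,a_{10}\in\mathbb C(t)$, has the Painlevé scheme $$\begin{pmatrix} X=0 & X=1 & X=t & X=\infty\\ f_0\begin{pmatrix}2&-\alpha_4\\0&1\end{pmatrix} & f_1\begin{pmatrix}2&-\alpha_3\\0&1\end{pmatrix} & f_2\begin{pmatrix}2&-\alpha_0\\0&1\end{pmatrix} & f_3\begin{pmatrix}2&-\alpha_1\\0&1\end{pmatrix}\end{pmatrix}$$ for some $f_0,f_1,f_2,f_3\in\mathbb C(t)$; that is, $X=0,1,t,\infty$ are accessible singular points and the matrix of linear approximation at each of them is the one listed below it. Then the system coincides with the Painlevé VI Hamiltonian system $$\frac{dx}{dt}=\frac{\partial H_{VI}}{\partial y},\qquad \frac{dy}{dt}=-\frac{\partial H_{VI}}{\partial x},$$ $$H_{VI}=\frac{1}{t(t-1)}\Big[y^2(x-t)(x-1)x-\{(\alpha_0-1)(x-1)x+\alpha_3(x-t)x+\alpha_4(x-t)(x-1)\}y+\alpha_2(\alpha_1+\alpha_2)x\Big].$$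
   Context: System $(S)$: for a constant $\alpha_2\in\mathbb C$ and $a_i=a_i(t)\in\mathbb C(t)$, $$\frac{dx}{dt}=a_1x^3y+a_2x^2y+a_5xy+a_7y+\tfrac12\big((3a_1+2a_3)\alpha_2-a_4\big)x^2+\big((a_2+a_9)\alpha_2-a_6\big)x+a_8,$$ $$\frac{dy}{dt}=a_3x^2y^2+a_9xy^2+a_{10}y^2+a_4xy+a_6y+\tfrac12(a_1\alpha_2+a_4)\alpha_2 .$$ This system is also polynomial in the coordinates $(x_1,y_1)=(1/x,\,-(xy+\alpha_2)x)$. Local coordinates: at the point $X=c$ with $c\in\{0,1,t\}$ use $(X,Y)=(x-c,1/y)$ (for $c=t$ one has $dX/dt=dx/dt-1$); at $X=\infty$ use $(X,Y)=(x_1,1/y_1)$. In each of these coordinates the system has the form $\frac{dX}{dt}=\frac{G(X,Y)}{Y}$, $\frac{dY}{dt}=H(X,Y)$ with $G,H\in\mathbb C(t)[X,Y]$. The point $(X,Y)=(0,0)$ is an accessible singular point if $G(0,0)=0$. Its matrix of linear approximation is the matrix $M=\begin{pmatrix}M_{11}&M_{12}\\0&M_{22}\end{pmatrix}$ over $\mathbb C(t)$ such that $\frac{d}{dt}\binom{X}{Y}=\frac1Y\left\{M\binom XY+(\text{terms of order}\ge 2\text{ in }X,Y)\right\}$, i.e. $G=M_{11}X+M_{12}Y+O(2)$ and $H(0,0)=M_{22}$. A Painlevé scheme is a list of accessible singular points together with their matrices of linear approximation. *)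

theory Defs
  imports "HOL-Computational_Algebra.Computational_Algebra" "Jordan_Normal_Form.Matrix"
begin

section \<open>Derivations on polynomials and fractions\<close>

text \<open>The quotient rule: extension to the field of fractions of a derivation of a domain.
  For a derivation \<open>d\<close> the value does not depend on the chosen representation
  (lemma \<open>fract_deriv_Fract\<close>).\<close>

definition fract_deriv :: "('a::idom \<Rightarrow> 'a) \<Rightarrow> 'a fract \<Rightarrow> 'a fract" where
  "fract_deriv d f = (THE g. \<exists>n m. m \<noteq> 0 \<and> f = Fract n m \<and> g = Fract (d n * m - n * d m) (m * m))"

lemma fract_deriv_Fract:
  fixes d :: "'a::idom \<Rightarrow> 'a"
  assumes leibniz: "\<And>a b. d (a * b) = d a * b + a * d b" and m: "m \<noteq> 0"
  shows "fract_deriv d (Fract n m) = Fract (d n * m - n * d m) (m * m)"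
proof -
  have eq: "Fract (d k * l - k * d l) (l * l) = Fract (d n * m - n * d m) (m * m)"
    if l: "l \<noteq> 0" and f: "Fract n m = Fract k l" for k l
  proof -
    have 1: "n * l = k * m" using f l m by (simp add: eq_fract)
    have 2: "d n * l + n * d l = d k * m + k * d m"
      using arg_cong[OF 1, of d] by (simp add: leibniz)
    have "(d k * l - k * d l) * (m * m) - (d n * m - n * d m) * (l * l) = 
       (d k * m + k * d m - (d n * l + n * d l)) * (l * m)
       + (n * l - k * m) * (d m * l + d l * m)"
      by (simp add: algebra_simps)
    also have "\<dots> = 0" using 1 2 by simp
    finally show ?thesis using l m by (simp add: eq_fract)
  qed
  show ?thesis unfolding fract_deriv_def
  proof (rule the_equality)
    show "\<exists>k l. l \<noteq> 0 \<and> Fract n m = Fract k l \<and>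
        Fract (d n * m - n * d m) (m * m) = Fract (d k * l - k * d l) (l * l)"
      using m by blast
  qed (use eq in auto)
qed

lemma fract_deriv_to_fract:
  fixes d :: "'a::idom \<Rightarrow> 'a"
  assumes leibniz: "\<And>a b. d (a * b) = d a * b + a * d b"
  shows "fract_deriv d (to_fract a) = to_fract (d a)"
proof -
  have "d 1 = d 1 + d 1" using leibniz[of 1 1] by (simp del: one_add_one)
  then have "d 1 = 0" by (metis add_cancel_left_left)
  then show ?thesis unfolding to_fract_def using fract_deriv_Fract[OF leibniz, of 1 a] by simp
qed

lemma fract_deriv_mult:
  fixes d :: "'a::idom \<Rightarrow> 'a"
  assumes leibniz: "\<And>a b. d (a * b) = d a * b + a * d b"
  shows "fract_deriv d (f * g) = fract_deriv d f * g + f * fract_deriv d g"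
proof -
  obtain a b where f: "f = Fract a b" "b \<noteq> 0" by (cases f)
  obtain a' b' where g: "g = Fract a' b'" "b' \<noteq> 0" by (cases g)
  show ?thesis using f g
    by (simp add: fract_deriv_Fract[OF leibniz] eq_fract) (simp add: leibniz algebra_simps)
qed

lemma fract_deriv_add:
  fixes d :: "'a::idom \<Rightarrow> 'a"
  assumes leibniz: "\<And>a b. d (a * b) = d a * b + a * d b"
    and add: "\<And>a b. d (a + b) = d a + d b"
  shows "fract_deriv d (f + g) = fract_deriv d f + fract_deriv d g"
proof -
  obtain a b where f: "f = Fract a b" "b \<noteq> 0" by (cases f)
  obtain a' b' where g: "g = Fract a' b'" "b' \<noteq> 0" by (cases g)
  show ?thesis using f g
    by (simp add: fract_deriv_Fract[OF leibniz] eq_fract) (simp add: leibniz add algebra_simps)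
qed

lemma map_poly_deriv_add:
  fixes d :: "'a::comm_ring_1 \<Rightarrow> 'a"
  assumes add: "\<And>a b. d (a + b) = d a + d b"
  shows "map_poly d (p + q) = map_poly d p + map_poly d q"
proof -
  have "d 0 = 0" using add[of 0 0] by simp
  then show ?thesis by (intro poly_eqI) (simp add: coeff_map_poly add)
qed

lemma map_poly_deriv_mult:
  fixes d :: "'a::comm_ring_1 \<Rightarrow> 'a"
  assumes leibniz: "\<And>a b. d (a * b) = d a * b + a * d b"
    and add: "\<And>a b. d (a + b) = d a + d b"
  shows "map_poly d (p * q) = map_poly d p * q + p * map_poly d q"
proof -
  have d0: "d 0 = 0" using add[of 0 0] by simp
  have dsum: "d (sum f A) = (\<Sum>i\<in>A. d (f i))" for f and A :: "nat set"
    by (induction A rule: infinite_finite_induct) (simp_all add: d0 add)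
  show ?thesis
    by (intro poly_eqI) (simp add: coeff_map_poly d0 coeff_mult dsum leibniz sum.distrib)
qed


section \<open>Systems over \<open>\<complex>(t)\<close> and their derivations\<close>

text \<open>\<open>ratfun\<close> is \<open>\<complex>(t)\<close>; \<open>xypoly\<close> is \<open>\<complex>(t)[x][y]\<close>, i.e. the outer variable is \<open>y\<close>, and
  \<open>coeff (coeff p j) i\<close> is the coefficient of \<open>x\<^sup>i y\<^sup>j\<close>; \<open>xyfract\<close> is \<open>\<complex>(t)(x,y)\<close>.\<close>

type_synonym ratfun = "complex poly fract"
type_synonym xypoly = "ratfun poly poly"
type_synonym xyfract = "xypoly fract"

definition cnst :: "complex \<Rightarrow> ratfun" where "cnst c = to_fract [:c:]"
definition tt :: ratfun where "tt = to_fract [:0, 1:]"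
definition ddt :: "ratfun \<Rightarrow> ratfun" where "ddt = fract_deriv pderiv"

definition CC :: "ratfun \<Rightarrow> xypoly" where "CC a = [:[:a:]:]"
definition xx :: xypoly where "xx = [:[:0, 1:]:]"
definition yy :: xypoly where "yy = [:0, 1:]"

definition part_t :: "xypoly \<Rightarrow> xypoly" where "part_t = map_poly (map_poly ddt)"
definition part_x :: "xypoly \<Rightarrow> xypoly" where "part_x = map_poly pderiv"
definition part_y :: "xypoly \<Rightarrow> xypoly" where "part_y = pderiv"

text \<open>A pair \<open>(P, Q)\<close> stands for the system \<open>dx/dt = P\<close>, \<open>dy/dt = Q\<close>.  It makes \<open>d/dt\<close> a
  derivation of \<open>\<complex>(t)(x,y)\<close>, by which a system is rewritten in other coordinates.\<close>

type_synonym system = "xypoly \<times> xypoly"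

definition total_deriv :: "system \<Rightarrow> xyfract \<Rightarrow> xyfract" where
  "total_deriv S = fract_deriv (\<lambda>p. part_t p + fst S * part_x p + snd S * part_y p)"

lemma ddt_mult: "ddt (a * b) = ddt a * b + a * ddt b"
  unfolding ddt_def by (rule fract_deriv_mult) (simp add: pderiv_mult algebra_simps)

lemma ddt_add: "ddt (a + b) = ddt a + ddt b"
  unfolding ddt_def
  by (rule fract_deriv_add) (simp_all add: pderiv_mult pderiv_add algebra_simps)

lemma ddt_cnst: "ddt (cnst c) = 0"
  unfolding ddt_def cnst_def
  by (subst fract_deriv_to_fract) (simp_all add: pderiv_mult pderiv_pCons algebra_simps)

lemma ddt_tt: "ddt tt = 1"
  unfolding ddt_def tt_def
  by (subst fract_deriv_to_fract) (simp_all add: pderiv_mult pderiv_pCons algebra_simps one_pCons[symmetric])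

lemma poly_deriv_mult:
  "part_t (p * q) + P * part_x (p * q) + Q * part_y (p * q) =
   (part_t p + P * part_x p + Q * part_y p) * q + p * (part_t q + P * part_x q + Q * part_y q)"
proof -
  have 1: "part_t (p * q) = part_t p * q + p * part_t q" unfolding part_t_def
    by (intro map_poly_deriv_mult map_poly_deriv_add ddt_mult ddt_add)
  have 2: "part_x (p * q) = part_x p * q + p * part_x q" unfolding part_x_def
    by (intro map_poly_deriv_mult) (simp_all add: pderiv_mult pderiv_add algebra_simps)
  have 3: "part_y (p * q) = part_y p * q + p * part_y q" unfolding part_y_def
    by (simp add: pderiv_mult algebra_simps)
  show ?thesis unfolding 1 2 3 by (simp add: algebra_simps)
qed

lemma total_deriv_to_fract:
  "total_deriv S (to_fract p) = to_fract (part_t p + fst S * part_x p + snd S * part_y p)"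
  unfolding total_deriv_def by (rule fract_deriv_to_fract) (rule poly_deriv_mult)

lemma total_deriv_mult:
  "total_deriv S (f * g) = total_deriv S f * g + f * total_deriv S g"
  unfolding total_deriv_def by (rule fract_deriv_mult) (rule poly_deriv_mult)

lemma total_deriv_add: "total_deriv S (f + g) = total_deriv S f + total_deriv S g"
  unfolding total_deriv_def
proof (rule fract_deriv_add, rule poly_deriv_mult)
  fix p q :: xypoly
  have "part_t (p + q) = part_t p + part_t q" unfolding part_t_def
    by (intro map_poly_deriv_add ddt_add)
  moreover have "part_x (p + q) = part_x p + part_x q" unfolding part_x_def
    by (intro map_poly_deriv_add) (simp add: pderiv_add)
  moreover have "part_y (p + q) = part_y p + part_y q" unfolding part_y_def
    by (simp add: pderiv_add)
  ultimately show "part_t (p + q) + fst S * part_x (p + q) + snd S * part_y (p + q) =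
    part_t p + fst S * part_x p + snd S * part_y p + (part_t q + fst S * part_x q + snd S * part_y q)"
    by (simp add: algebra_simps)
qed

lemma total_deriv_generators:
  "total_deriv S (to_fract xx) = to_fract (fst S)"
  "total_deriv S (to_fract yy) = to_fract (snd S)"
  "total_deriv S (to_fract (CC a)) = to_fract (CC (ddt a))"
proof -
  have "ddt 0 = 0" "ddt 1 = 0" using ddt_cnst[of 0] ddt_cnst[of 1]
    by (simp_all add: cnst_def one_pCons[symmetric])
  then have d: "map_poly ddt [:a:] = [:ddt a:]" "map_poly ddt [:0, 1:] = 0" "ddt 0 = 0" "ddt 1 = 0"
    for a by (simp_all add: map_poly_pCons)
  show "total_deriv S (to_fract xx) = to_fract (fst S)"
    by (simp add: total_deriv_to_fract part_t_def part_x_def part_y_def xx_def map_poly_pCons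
        pderiv_pCons d map_poly_1 one_pCons[symmetric])
  show "total_deriv S (to_fract yy) = to_fract (snd S)"
    by (simp add: total_deriv_to_fract part_t_def part_x_def part_y_def yy_def map_poly_pCons
        pderiv_pCons d map_poly_1)
  show "total_deriv S (to_fract (CC a)) = to_fract (CC (ddt a))"
    by (simp add: total_deriv_to_fract part_t_def part_x_def part_y_def CC_def map_poly_pCons
        pderiv_pCons d)
qed


section \<open>The system (S) and the Painleve VI Hamiltonian system\<close>

text \<open>Only the coefficients \<open>a 1, \<dots>, a 10\<close> occur.\<close>

definition system_S :: "complex \<Rightarrow> (nat \<Rightarrow> ratfun) \<Rightarrow> system" where
  "system_S \<alpha>\<^sub>2 a = (let A = cnst \<alpha>\<^sub>2 in
    (CC (a 1) * xx^3 * yy + CC (a 2) * xx^2 * yy + CC (a 5) * xx * yy + CC (a 7) * yy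
       + CC (1/2 * ((3 * a 1 + 2 * a 3) * A - a 4)) * xx^2
       + CC ((a 2 + a 9) * A - a 6) * xx + CC (a 8),
     CC (a 3) * xx^2 * yy^2 + CC (a 9) * xx * yy^2 + CC (a 10) * yy^2
       + CC (a 4) * xx * yy + CC (a 6) * yy + CC (1/2 * (a 1 * A + a 4) * A)))"

definition H_VI :: "complex \<Rightarrow> complex \<Rightarrow> complex \<Rightarrow> complex \<Rightarrow> complex \<Rightarrow> xypoly" where
  "H_VI \<alpha>\<^sub>0 \<alpha>\<^sub>1 \<alpha>\<^sub>2 \<alpha>\<^sub>3 \<alpha>\<^sub>4 = CC (1 / (tt * (tt - 1))) *
     (yy^2 * (xx - CC tt) * (xx - 1) * xx
      - (CC (cnst (\<alpha>\<^sub>0 - 1)) * (xx - 1) * xx + CC (cnst \<alpha>\<^sub>3) * (xx - CC tt) * xx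
         + CC (cnst \<alpha>\<^sub>4) * (xx - CC tt) * (xx - 1)) * yy
      + CC (cnst (\<alpha>\<^sub>2 * (\<alpha>\<^sub>1 + \<alpha>\<^sub>2))) * xx)"

definition hamiltonian_system :: "xypoly \<Rightarrow> system" where
  "hamiltonian_system H = (part_y H, - part_x H)"


section \<open>Accessible singular points and Painleve schemes\<close>

datatype spoint = Finite ratfun | Infinity

text \<open>The local coordinates \<open>(X, Y)\<close> as elements of \<open>\<complex>(t)(x,y)\<close>: \<open>(x - c, 1/y)\<close> at \<open>X = c\<close>,
  and \<open>(x\<^sub>1, 1/y\<^sub>1)\<close> with \<open>(x\<^sub>1, y\<^sub>1) = (1/x, -(xy + \<alpha>\<^sub>2)x)\<close> at \<open>X = \<infinity>\<close>.\<close>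

fun local_coords :: "complex \<Rightarrow> spoint \<Rightarrow> xyfract \<times> xyfract" where
  "local_coords \<alpha>\<^sub>2 (Finite c) = (to_fract (xx - CC c), 1 / to_fract yy)"
| "local_coords \<alpha>\<^sub>2 Infinity =
     (1 / to_fract xx, 1 / to_fract (- (xx * yy + CC (cnst \<alpha>\<^sub>2)) * xx))"

text \<open>Substitution \<open>G(X, Y)\<close>.\<close>

definition eval_xy :: "xypoly \<Rightarrow> xyfract \<Rightarrow> xyfract \<Rightarrow> xyfract" where
  "eval_xy G X Y = poly (map_poly (\<lambda>p. poly (map_poly (\<lambda>a. to_fract (CC a)) p) X) G) Y"

text \<open>The system has the form \<open>dX/dt = G(X,Y)/Y\<close>, \<open>dY/dt = H(X,Y)\<close> at the given point.  The
  polynomials \<open>G\<close> and \<open>H\<close> are then unique, since \<open>X\<close> and \<open>Y\<close> are algebraically independent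
  over \<open>\<complex>(t)\<close>.\<close>

definition local_form :: "complex \<Rightarrow> system \<Rightarrow> spoint \<Rightarrow> xypoly \<Rightarrow> xypoly \<Rightarrow> bool" where
  "local_form \<alpha>\<^sub>2 S p G H \<longleftrightarrow> (let (X, Y) = local_coords \<alpha>\<^sub>2 p in
     total_deriv S X = eval_xy G X Y / Y \<and> total_deriv S Y = eval_xy H X Y)"

definition accessible_singular_point :: "complex \<Rightarrow> system \<Rightarrow> spoint \<Rightarrow> bool" where
  "accessible_singular_point \<alpha>\<^sub>2 S p \<longleftrightarrow>
     (\<exists>G H. local_form \<alpha>\<^sub>2 S p G H \<and> coeff (coeff G 0) 0 = 0)"

definition order_ge2 :: "xypoly \<Rightarrow> bool" where
  "order_ge2 R \<longleftrightarrow> (\<forall>i j. i + j < 2 \<longrightarrow> coeff (coeff R j) i = 0)"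

text \<open>\<open>d/dt (X,Y)\<^sup>T = (1/Y) {M (X,Y)\<^sup>T + (terms of order \<ge> 2)}\<close>.  As \<open>Y dY/dt = Y H(X,Y)\<close> has no
  term \<open>X\<close>, this forces the lower left entry of \<open>M\<close> to be \<open>0\<close> and the lower right one to be
  \<open>H(0,0)\<close>.\<close>

definition linear_approximation ::
    "complex \<Rightarrow> system \<Rightarrow> spoint \<Rightarrow> ratfun mat \<Rightarrow> bool" where
  "linear_approximation \<alpha>\<^sub>2 S p M \<longleftrightarrow> M \<in> carrier_mat 2 2 \<and>
     (\<exists>G H. local_form \<alpha>\<^sub>2 S p G H \<and>
        order_ge2 (G - (CC (M $$ (0,0)) * xx + CC (M $$ (0,1)) * yy)) \<and>
        order_ge2 (yy * H - (CC (M $$ (1,0)) * xx + CC (M $$ (1,1)) * yy)))"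

definition has_painleve_scheme ::
    "complex \<Rightarrow> system \<Rightarrow> (spoint \<times> ratfun mat) list \<Rightarrow> bool" where
  "has_painleve_scheme \<alpha>\<^sub>2 S scheme \<longleftrightarrow> (\<forall>(p, M) \<in> set scheme.
     accessible_singular_point \<alpha>\<^sub>2 S p \<and> linear_approximation \<alpha>\<^sub>2 S p M)"

end

theory Submission
  imports Defs
begin

text \<open>Both the system \<open>(S)\<close> and the Painleve VI system have the shape
  \<open>dx/dt = P y + Q\<close>, \<open>dy/dt = R y\<^sup>2 + S y + E\<close> with \<open>P, Q, R, S, E\<close> polynomials in \<open>x\<close> over
  \<open>\<complex>(t)\<close>, where \<open>P\<close> has degree at most 3 and \<open>Q, R\<close> have degree at most 2.

  In the coordinates \<open>(X, Y) = (x - c, 1/y)\<close> the system is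
  \<open>dX/dt = (P(X + c) + (Q(X + c) - c') Y) / Y\<close>,
  \<open>dY/dt = - R(X + c) - S(X + c) Y - E(X + c) Y\<^sup>2\<close>.  So the linear approximation
  \<open>f (2, -\<beta>; 0, 1)\<close> at \<open>X = c\<close> says
  \<open>P(c) = 0\<close>, \<open>P'(c) = 2 f\<close>, \<open>Q(c) - c' = - f \<beta>\<close> and \<open>R(c) = - f\<close>
  (lemma \<open>linear_approximation_finite\<close>).  At infinity the first row of the matrix gives the
  leading coefficients of \<open>P\<close> and \<open>Q\<close> (lemma \<open>linear_approximation_infinity\<close>).  These readings are legitimate
  because the numerators of a local form are unique, \<open>X\<close> and \<open>Y\<close> being algebraically
  independent (lemma \<open>eval_xy_inject\<close>).

  The conditions at \<open>0, 1, t\<close> and at infinity give \<open>P = 2 f\<^sub>3 x (x - 1) (x - t)\<close>.  Then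
  \<open>f\<^sub>0, f\<^sub>1, f\<^sub>2\<close> are the values of \<open>P'/2\<close>, so \<open>R = - P'/2\<close>, as these quadratic polynomials
  agree at three points.  The polynomial \<open>Q\<close> is prescribed at three points, and its leading
  coefficient is prescribed as well, at infinity.  Only one multiple \<open>f\<^sub>3\<close> meets all four
  conditions, because \<open>c' = 1\<close> at \<open>c = t\<close> makes them inhomogeneous: with the relation
  between the parameters, they yield \<open>f\<^sub>3 = 1 / (t (t - 1))\<close>
  (lemma \<open>coefficients_from_scheme\<close>).  The remaining \<open>S\<close> and \<open>E\<close> are tied to \<open>P, Q, R\<close> by
  the form of \<open>(S)\<close>.\<close>

section \<open>Evaluation at a pair of rational functions\<close>

definition eval_x :: "ratfun poly \<Rightarrow> xyfract \<Rightarrow> xyfract" where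
  "eval_x p X = poly (map_poly (\<lambda>a. to_fract (CC a)) p) X"

lemma CC_simps: "CC 0 = 0" "CC 1 = 1" "CC (a + b) = CC a + CC b" "CC (- a) = - CC a"
  "CC (a - b) = CC a - CC b" "CC (a * b) = CC a * CC b"
  by (simp_all add: CC_def one_pCons)

lemma eval_x_0 [simp]: "eval_x 0 X = 0"
  by (simp add: eval_x_def)

lemma eval_x_pCons [simp]: "eval_x (pCons a p) X = to_fract (CC a) + X * eval_x p X"
  by (simp add: eval_x_def map_poly_pCons CC_simps)

lemma eval_x_add: "eval_x (p + q) X = eval_x p X + eval_x q X"
  by (induction p q rule: poly_induct2) (simp_all add: CC_simps algebra_simps)

lemma eval_x_diff: "eval_x (p - q) X = eval_x p X - eval_x q X"
  using eval_x_add[of "p - q" q X] by simp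

lemma eval_xy_0 [simp]: "eval_xy 0 X Y = 0"
  by (simp add: eval_xy_def)

lemma eval_xy_pCons [simp]: "eval_xy (pCons p G) X Y = eval_x p X + Y * eval_xy G X Y"
  by (simp add: eval_xy_def eval_x_def map_poly_pCons)

lemma eval_xy_add: "eval_xy (G + H) X Y = eval_xy G X Y + eval_xy H X Y"
  by (induction G H rule: poly_induct2) (simp_all add: eval_x_add algebra_simps)

lemma eval_xy_diff: "eval_xy (G - H) X Y = eval_xy G X Y - eval_xy H X Y"
  using eval_xy_add[of "G - H" H X Y] by simp

section \<open>Algebraic independence of local coordinates\<close>

text \<open>For an \<open>X\<close> in the subfield \<open>\<complex>(t)(x)\<close> this says that \<open>X\<close> is transcendental over
  \<open>\<complex>(t)\<close>.  It is phrased with cleared denominators, so that degrees in \<open>y\<close> can be compared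
  among polynomials.\<close>

definition transcendental_in_x :: "xyfract \<Rightarrow> bool" where
  "transcendental_in_x X \<longleftrightarrow>
    (\<forall>p. p \<noteq> 0 \<longrightarrow> (\<exists>W E. W \<noteq> 0 \<and> E \<noteq> 0 \<and> to_fract [:W:] * eval_x p X = to_fract [:E:]))"

lemma to_fract_power: "to_fract (a ^ n) = to_fract a ^ n"
  by (induction n) simp_all

lemma to_fract_smult: "to_fract (Polynomial.smult a p) = to_fract [:a:] * to_fract p"
  by (simp flip: to_fract_mult)

lemma to_fract_const_mult: "to_fract [:a * b:] = to_fract [:a:] * to_fract [:b:]"
  by (simp flip: to_fract_mult)

text \<open>A polynomial of degree \<open>n - 1\<close> or less in \<open>Y = 1/v\<close> becomes polynomial on multiplication
  by \<open>v\<^sup>n\<close> and a factor free of \<open>y\<close>.  The bound on the degree of the result in \<open>y\<close> is what the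
  comparison of degrees in the next lemma needs.\<close>

lemma clear_denominators:
  assumes X: "transcendental_in_x X" and v: "v \<noteq> 0"
  shows "\<exists>n W R. W \<noteq> 0 \<and> degree R \<le> n * degree v \<and>
    to_fract [:W:] * to_fract v ^ n * eval_xy D X (1 / to_fract v) = to_fract R"
proof (induction D)
  case 0
  show ?case by (intro exI[of _ 0] exI[of _ 1]) auto
next
  case (pCons d D)
  then obtain n W R where IH: "W \<noteq> 0" "degree R \<le> n * degree v"
    "to_fract [:W:] * to_fract v ^ n * eval_xy D X (1 / to_fract v) = to_fract R" by blast
  obtain U E where U: "U \<noteq> 0" "to_fract [:U:] * eval_x d X = to_fract [:E:]"
    using X by (cases "d = 0") (auto simp: transcendental_in_x_def intro: that[of 1 0])
  have "to_fract [:U * W:] * to_fract v ^ Suc n * eval_xy (pCons d D) X (1 / to_fract v) =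
      (to_fract [:U:] * eval_x d X) * to_fract [:W:] * to_fract v ^ Suc n
      + to_fract [:U:] * (to_fract [:W:] * to_fract v ^ n * eval_xy D X (1 / to_fract v))"
    using v by (simp add: to_fract_const_mult field_simps)
  also have "\<dots> = to_fract (Polynomial.smult (E * W) (v ^ Suc n) + Polynomial.smult U R)"
    unfolding U(2) IH(3) by (simp add: to_fract_smult to_fract_const_mult to_fract_power)
  finally have "to_fract [:U * W:] * to_fract v ^ Suc n * eval_xy (pCons d D) X (1 / to_fract v)
      = to_fract (Polynomial.smult (E * W) (v ^ Suc n) + Polynomial.smult U R)" .
  moreover have "degree (Polynomial.smult (E * W) (v ^ Suc n) + Polynomial.smult U R) \<le> Suc n * degree v"
    using IH(2) by (intro degree_add_le order_trans[OF degree_smult_le])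
      (auto simp: degree_power_eq v simp del: power_Suc)
  ultimately show ?case using U(1) IH(1) by (intro exI[of _ "Suc n"] exI[of _ "U * W"]) auto
qed


text \<open>In \<open>d(X) + Y D(X, Y) = 0\<close>, multiplied by \<open>v\<^bsup>n+1\<^esup>\<close>, the first term has degree
  \<open>(n + 1) deg v\<close> in \<open>y\<close> unless \<open>d = 0\<close>, and the second one has degree at most \<open>n deg v\<close>.
  So \<open>d = 0\<close>, a factor \<open>Y\<close> can be cancelled, and the induction goes on with \<open>D\<close>.\<close>

lemma eval_xy_eq_0:
  assumes X: "transcendental_in_x X" and v: "degree v > 0"
  shows "eval_xy D X (1 / to_fract v) = 0 \<Longrightarrow> D = 0"
proof (induction D)
  case (pCons d D)
  have v0: "v \<noteq> 0" using v by auto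
  obtain n W R where W: "W \<noteq> 0" "degree R \<le> n * degree v"
    "to_fract [:W:] * to_fract v ^ n * eval_xy D X (1 / to_fract v) = to_fract R"
    using clear_denominators[OF X v0] by blast
  have d: "d = 0"
  proof (rule ccontr)
    assume "d \<noteq> 0"
    then obtain U E where U: "U \<noteq> 0" "E \<noteq> 0" "to_fract [:U:] * eval_x d X = to_fract [:E:]"
      using X by (auto simp: transcendental_in_x_def)
    have "to_fract [:W:] * to_fract v ^ Suc n * to_fract [:U:] * eval_xy (pCons d D) X (1 / to_fract v) =
      to_fract [:W:] * to_fract v ^ Suc n * (to_fract [:U:] * eval_x d X) +
      to_fract [:U:] * (to_fract [:W:] * to_fract v ^ n * eval_xy D X (1 / to_fract v))"
      using v0 by (simp add: field_simps)
    also have "\<dots> = to_fract (Polynomial.smult (W * E) (v ^ Suc n) + Polynomial.smult U R)"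
      unfolding U(3) W(3) by (simp add: to_fract_smult to_fract_const_mult to_fract_power)
    finally have "Polynomial.smult (W * E) (v ^ Suc n) = - Polynomial.smult U R"
      using pCons.prems
      by (simp add: eq_neg_iff_add_eq_0 del: eval_xy_pCons power_Suc to_fract_add flip: to_fract_add)
    then have "degree (Polynomial.smult (W * E) (v ^ Suc n)) = degree (Polynomial.smult U R)" by simp
    then show False using W U v by (simp add: degree_power_eq v0 degree_mult_eq)
  qed
  with pCons v0 have "D = 0" by simp
  with d pCons show ?case by simp
qed simp

text \<open>The numerators in a local form are thus unique, so that exhibiting one pair of them
  determines the linear approximation.\<close>

lemma eval_xy_inject:
  assumes "transcendental_in_x X" "degree v > 0" "eval_xy G X (1 / to_fract v) = eval_xy H X (1 / to_fract v)"
  shows "G = H"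
  using eval_xy_eq_0[OF assms(1,2), of "G - H"] assms(3) by (simp add: eval_xy_diff)

lemma eval_x_shift: "eval_x p (to_fract (xx - CC c)) = to_fract [:pcompose p [:- c, 1:]:]"
  by (induction p) (simp_all add: pcompose_pCons xx_def CC_def flip: to_fract_mult to_fract_add to_fract_diff)

lemma transcendental_in_x_shift: "transcendental_in_x (to_fract (xx - CC c))"
  unfolding transcendental_in_x_def eval_x_shift
proof (intro allI impI)
  fix p :: "ratfun poly" assume "p \<noteq> 0"
  then have "pcompose p [:- c, 1:] \<noteq> 0" by (simp add: pcompose_eq_0_iff)
  then show "\<exists>W E. W \<noteq> 0 \<and> E \<noteq> 0 \<and> to_fract [:W:] * to_fract [:pcompose p [:- c, 1:]:] = to_fract [:E:]"
    by (intro exI[of _ 1] exI[of _ "pcompose p [:- c, 1:]"]) (simp add: one_pCons[symmetric])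
qed

lemma eval_x_inverse:
  "to_fract [:monom 1 (degree p):] * eval_x p (1 / to_fract xx) = to_fract [:reflect_poly p:]"
proof (induction p)
  case (pCons a p)
  have x0: "xx \<noteq> 0" by (simp add: xx_def)
  show ?case
  proof (cases "p = 0")
    case True
    then show ?thesis by (simp add: CC_def one_pCons[symmetric])
  next
    case False
    have m: "[:monom 1 (Suc (degree p)):] = xx * [:monom 1 (degree p):]"
      by (simp add: xx_def monom_Suc)
    have "to_fract [:monom 1 (degree (pCons a p)):] * eval_x (pCons a p) (1 / to_fract xx) =
       to_fract (xx * [:monom 1 (degree p):]) *
         (to_fract (CC a) + 1 / to_fract xx * eval_x p (1 / to_fract xx))"
      using False by (simp add: m)
    also have "\<dots> = to_fract [:monom 1 (degree p):] * eval_x p (1 / to_fract xx)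
        + to_fract (CC a) * to_fract [:monom 1 (Suc (degree p)):]"
      unfolding m to_fract_mult using x0 by (simp add: field_simps del: mult_pCons_right)
    also have "\<dots> = to_fract [:reflect_poly (pCons a p):]"
      using False unfolding pCons.IH
      by (simp add: reflect_poly_pCons' CC_def smult_monom flip: to_fract_add to_fract_mult)
    finally show ?thesis .
  qed
qed simp

lemma transcendental_in_x_inverse: "transcendental_in_x (1 / to_fract xx)"
  unfolding transcendental_in_x_def
proof (intro allI impI)
  fix p :: "ratfun poly" assume "p \<noteq> 0"
  then show "\<exists>W E. W \<noteq> 0 \<and> E \<noteq> 0 \<and> to_fract [:W:] * eval_x p (1 / to_fract xx) = to_fract [:E:]"
    using eval_x_inverse[of p] by (intro exI[of _ "monom 1 (degree p)"] exI[of _ "reflect_poly p"]) simp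
qed

section \<open>Linear approximations of systems quadratic in y\<close>

lemma total_deriv_inverse:
  assumes "f \<noteq> 0" shows "total_deriv S (1 / f) = - total_deriv S f / f\<^sup>2"
proof -
  have "total_deriv S 1 = total_deriv S 1 + total_deriv S 1" using total_deriv_mult[of S 1 1] by simp
  then have "total_deriv S 1 = 0" by (metis add_cancel_left_left)
  moreover have "total_deriv S (f * (1 / f)) = total_deriv S f * (1 / f) + f * total_deriv S (1 / f)"
    by (rule total_deriv_mult)
  ultimately show ?thesis using assms by (simp add: power2_eq_square field_simps eq_neg_iff_add_eq_0)
qed

lemma total_deriv_shift: "total_deriv S (to_fract (xx - CC c)) = to_fract (fst S - CC (ddt c))"
proof -
  have "total_deriv S (to_fract (xx - CC c) + to_fract (CC c)) =
      total_deriv S (to_fract (xx - CC c)) + total_deriv S (to_fract (CC c))"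
    by (rule total_deriv_add)
  then show ?thesis using total_deriv_generators[of S] by (simp add: algebra_simps)
qed

lemma order_ge2_linear:
  assumes "order_ge2 (G - (CC a * xx + CC b * yy))"
  shows "coeff (coeff G 0) 0 = 0" "coeff (coeff G 0) 1 = a" "coeff (coeff G 1) 0 = b"
proof -
  have *: "coeff (coeff (G - (CC a * xx + CC b * yy)) j) i = 0" if "i + j < 2" for i j
    using assms that by (auto simp: order_ge2_def)
  show "coeff (coeff G 0) 0 = 0" "coeff (coeff G 0) 1 = a" "coeff (coeff G 1) 0 = b"
    using *[of 0 0] *[of 1 0] *[of 0 1] by (simp_all add: CC_def xx_def yy_def)
qed

lemma pcompose_shift_inverse: "pcompose (pcompose p [:c, 1:]) [:- c, 1:] = (p :: 'a::comm_ring_1 poly)"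
  by (simp flip: pcompose_assoc add: pcompose_pCons)

lemma coeff_1_shift: "coeff (pcompose p [:c, 1:]) 1 = poly (pderiv p) (c :: 'a::idom)"
proof -
  have "coeff (pcompose p [:c, 1:]) 1 = coeff (pderiv (pcompose p [:c, 1:])) 0"
    by (simp add: coeff_pderiv)
  then show ?thesis by (simp add: pderiv_pcompose pcompose_coeff_0 pderiv_pCons)
qed

text \<open>From \<open>dX/dt = P y + Q - c'\<close> and \<open>dY/dt = - Y\<^sup>2 dy/dt\<close> with \<open>y = 1/Y\<close>, the numerators are
  \<open>G = P(X + c) + (Q(X + c) - c') Y\<close> and \<open>H = - R(X + c) - S(X + c) Y - E(X + c) Y\<^sup>2\<close>; the
  assertions are the low order coefficients of \<open>G\<close> and the constant one of \<open>H\<close>.\<close>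

lemma linear_approximation_finite:
  assumes "linear_approximation \<alpha> ([:Q, P:], [:E, S, R:]) (Finite c) M"
  shows "poly P c = 0" "poly (pderiv P) c = M $$ (0,0)"
    "poly Q c - ddt c = M $$ (0,1)" "poly R c = - M $$ (1,1)"
proof -
  let ?X = "to_fract (xx - CC c)"
  have y0: "yy \<noteq> 0" by (simp add: yy_def)
  obtain G H where l: "local_form \<alpha> ([:Q, P:], [:E, S, R:]) (Finite c) G H"
    and g: "order_ge2 (G - (CC (M $$ (0,0)) * xx + CC (M $$ (0,1)) * yy))"
    and h: "order_ge2 (yy * H - (CC (M $$ (1,0)) * xx + CC (M $$ (1,1)) * yy))"
    using assms unfolding linear_approximation_def by blast
  have G: "eval_xy G ?X (1 / to_fract yy) * to_fract yy = to_fract [:Q - [:ddt c:], P:]"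
    and H: "eval_xy H ?X (1 / to_fract yy) = - to_fract [:E, S, R:] / to_fract yy ^ 2"
    using l y0 total_deriv_shift[of "([:Q, P:], [:E, S, R:])" c]
    by (auto simp: local_form_def total_deriv_inverse total_deriv_generators CC_def simp del: to_fract_diff)
  let ?s = "\<lambda>p. pcompose p [:c, 1:]"
  have y: "[:a, b:] = [:a:] + yy * [:b:]" "[:a, b, e:] = [:a:] + yy * [:b:] + yy^2 * [:e:]" for a b e
    by (simp_all add: yy_def power2_eq_square)
  have G1: "G = [:?s P, ?s (Q - [:ddt c:]):]"
  proof (rule eval_xy_inject[OF transcendental_in_x_shift[of c], of yy])
    show "eval_xy G ?X (1 / to_fract yy) = eval_xy [:?s P, ?s (Q - [:ddt c:]):] ?X (1 / to_fract yy)"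
      using G y0 unfolding y(1)[of "Q - [:ddt c:]" P]
      by (simp add: eval_x_shift pcompose_shift_inverse to_fract_smult field_simps
          del: to_fract_diff diff_pCons)
  qed (simp add: yy_def)
  have H1: "H = [:- ?s R, - ?s S, - ?s E:]"
  proof (rule eval_xy_inject[OF transcendental_in_x_shift[of c], of yy])
    have m: "to_fract [:- p:] = - to_fract [:p:]" for p :: "ratfun poly" by (simp flip: to_fract_uminus)
    show "eval_xy H ?X (1 / to_fract yy) = eval_xy [:- ?s R, - ?s S, - ?s E:] ?X (1 / to_fract yy)"
      using y0 unfolding H y(2)[of E S R]
      by (simp add: eval_x_shift pcompose_uminus pcompose_shift_inverse m to_fract_smult field_simps
          power2_eq_square del: to_fract_diff diff_pCons)
  qed (simp add: yy_def)
  from order_ge2_linear[OF g]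
  show "poly P c = 0" "poly (pderiv P) c = M $$ (0,0)" "poly Q c - ddt c = M $$ (0,1)"
    unfolding G1 coeff_pCons_0 coeff_1_shift by (simp_all add: pcompose_coeff_0)
  from order_ge2_linear(3)[OF h] have "- poly R c = M $$ (1,1)"
    unfolding H1 by (simp add: yy_def pcompose_coeff_0)
  then show "poly R c = - M $$ (1,1)" by (metis minus_minus)
qed

text \<open>Since \<open>y = -(X y\<^sub>1 + \<alpha>) X\<close> and \<open>dX/dt = - X\<^sup>2 dx/dt\<close>, the numerator is
  \<open>G = p X + (\<alpha> p - q) Y\<close> with the reversed polynomials \<open>p = X\<^sup>3 P(1/X)\<close> and
  \<open>q = X\<^sup>2 Q(1/X)\<close>; their constant coefficients are the leading ones of \<open>P\<close> and \<open>Q\<close>.\<close>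

lemma linear_approximation_infinity:
  assumes "linear_approximation \<alpha> ([:[:q0, q1, q2:], [:p0, p1, p2, p3:]:], T) Infinity M"
  shows "p3 = M $$ (0,0)" "cnst \<alpha> * p3 - q2 = M $$ (0,1)"
proof -
  let ?P = "[:p3, p2, p1, p0:]" and ?Q = "[:q2, q1, q0:]" and ?A = "cnst \<alpha>"
  let ?v = "- (xx * yy + CC ?A) * xx"
  have v: "?v = [:[:0, - ?A:], [:0, 0, -1:]:]" by (simp add: xx_def yy_def CC_def)
  have x0: "xx \<noteq> 0" by (simp add: xx_def)
  have w0: "xx * yy + CC ?A \<noteq> 0" by (simp add: xx_def yy_def CC_def)
  then have v0: "to_fract xx * to_fract yy + to_fract (CC ?A) \<noteq> 0"
    by (simp flip: to_fract_mult to_fract_add)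
  then have v1: "- (to_fract xx * to_fract yy) \<noteq> to_fract (CC ?A)" by (metis add.right_inverse)
  have vnz: "to_fract ?v \<noteq> 0"
    using w0 x0 unfolding to_fract_eq_0_iff mult_eq_0_iff neg_equal_0_iff_equal by blast
  let ?G = "[:pCons 0 ?P, Polynomial.smult ?A ?P - ?Q:]"
  obtain G H where l: "local_form \<alpha> ([:[:q0, q1, q2:], [:p0, p1, p2, p3:]:], T) Infinity G H"
    and g: "order_ge2 (G - (CC (M $$ (0,0)) * xx + CC (M $$ (0,1)) * yy))"
    using assms unfolding linear_approximation_def by blast
  have f: "[:[:q0, q1, q2:], [:p0, p1, p2, p3:]:] = CC q0 + CC q1 * xx + CC q2 * xx^2 +
      yy * (CC p0 + CC p1 * xx + CC p2 * xx^2 + CC p3 * xx^3)"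
    by (simp add: CC_def xx_def yy_def power2_eq_square power3_eq_cube)
  have "eval_xy G (1 / to_fract xx) (1 / to_fract ?v) * to_fract ?v
     = - to_fract [:[:q0, q1, q2:], [:p0, p1, p2, p3:]:] / to_fract xx ^ 2"
    using l x0 by (simp add: local_form_def total_deriv_inverse total_deriv_generators)
  then have G: "eval_xy G (1 / to_fract xx) (1 / to_fract ?v)
     = - to_fract [:[:q0, q1, q2:], [:p0, p1, p2, p3:]:] / to_fract xx ^ 2 / to_fract ?v"
    by (subst nonzero_eq_divide_eq[OF vnz])
  have "G = ?G"
  proof (rule eval_xy_inject[OF transcendental_in_x_inverse, of ?v])
    show "eval_xy G (1 / to_fract xx) (1 / to_fract ?v) = eval_xy ?G (1 / to_fract xx) (1 / to_fract ?v)"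
      unfolding G f using x0 v0 v1
      by (simp add: to_fract_power CC_simps divide_simps)
        (simp add: algebra_simps power2_eq_square power3_eq_cube)
    show "degree ?v > 0" unfolding v by simp
  qed
  with order_ge2_linear[OF g] show "p3 = M $$ (0,0)" "cnst \<alpha> * p3 - q2 = M $$ (0,1)"
    by simp_all
qed

section \<open>The two systems in explicit form\<close>

lemma cnst_simps: "cnst (a + b) = cnst a + cnst b" "cnst (a - b) = cnst a - cnst b"
  "cnst (a * b) = cnst a * cnst b" "cnst 1 = 1" "cnst 0 = 0" "cnst 2 = 2"
proof -
  show *: "cnst (a + b) = cnst a + cnst b" "cnst 1 = 1" for a b
    by (simp_all add: cnst_def one_pCons[symmetric] flip: to_fract_add)
  show "cnst 2 = 2" using *(1)[of 1 1] by (simp add: *(2))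
qed (simp_all add: cnst_def flip: to_fract_diff to_fract_mult)

lemma tt_nz: "tt \<noteq> 0" "tt \<noteq> 1"
proof -
  have "to_fract ([:0, 1:] :: complex poly) \<noteq> to_fract 1"
    unfolding to_fract_eq_iff by (simp add: one_pCons)
  then show "tt \<noteq> 0" "tt \<noteq> 1" by (simp_all add: tt_def)
qed

lemma two_nz: "(2::ratfun) \<noteq> 0"
proof -
  have "to_fract (2 :: complex poly) = 1 + 1"
    unfolding to_fract_1[symmetric] to_fract_add[symmetric] by simp
  then show ?thesis by (metis one_add_one to_fract_eq_0_iff zero_neq_numeral)
qed

lemma system_S_eq: "system_S \<alpha> a =
  ([:[:a 8, (a 2 + a 9) * cnst \<alpha> - a 6, 1/2 * ((3 * a 1 + 2 * a 3) * cnst \<alpha> - a 4):], [:a 7, a 5, a 2, a 1:]:],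
   [:[:1/2 * (a 1 * cnst \<alpha> + a 4) * cnst \<alpha>:], [:a 6, a 4:], [:a 10, a 9, a 3:]:])"
  by (simp add: system_S_def Let_def CC_def xx_def yy_def power2_eq_square power3_eq_cube)

lemma hamiltonian_system_H_VI_eq:
  fixes \<alpha>\<^sub>0 \<alpha>\<^sub>1 \<alpha>\<^sub>2 \<alpha>\<^sub>3 \<alpha>\<^sub>4 :: complex
  defines "h \<equiv> 1 / (tt * (tt - 1))" and "b0 \<equiv> cnst \<alpha>\<^sub>0 - 1" and "b3 \<equiv> cnst \<alpha>\<^sub>3" and "b4 \<equiv> cnst \<alpha>\<^sub>4"
  shows "hamiltonian_system (H_VI \<alpha>\<^sub>0 \<alpha>\<^sub>1 \<alpha>\<^sub>2 \<alpha>\<^sub>3 \<alpha>\<^sub>4) =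
   ([:[:- h * b4 * tt, h * (b0 + b3 * tt + b4 * (1 + tt)), - h * (b0 + b3 + b4):],
      [:0, 2 * h * tt, - 2 * h * (1 + tt), 2 * h:]:],
    [:[:- h * cnst \<alpha>\<^sub>2 * (cnst \<alpha>\<^sub>1 + cnst \<alpha>\<^sub>2):], [:- h * (b0 + b3 * tt + b4 * (1 + tt)), 2 * h * (b0 + b3 + b4):],
      [:- h * tt, 2 * h * (1 + tt), - 3 * h:]:])"
proof -
  have CCx: "CC c * [:p, q, r:] = [:Polynomial.smult c p, Polynomial.smult c q, Polynomial.smult c r:]" for c p q r
    by (simp add: CC_def)
  have y2: "yy^2 * (xx - CC tt) * (xx - 1) * xx = [:0, 0, [:0, tt, - (1 + tt), 1:]:]"
    by (simp add: CC_def xx_def yy_def power2_eq_square one_pCons)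
  have y1: "(CC (cnst (\<alpha>\<^sub>0 - 1)) * (xx - 1) * xx + CC b3 * (xx - CC tt) * xx
         + CC b4 * (xx - CC tt) * (xx - 1)) * yy =
      [:0, [:b4 * tt, - (b0 + b3 * tt + b4 * (1 + tt)), b0 + b3 + b4:]:]"
    by (simp add: CC_def xx_def yy_def one_pCons cnst_simps b0_def algebra_simps)
  have y0: "CC (cnst (\<alpha>\<^sub>2 * (\<alpha>\<^sub>1 + \<alpha>\<^sub>2))) * xx = [:[:0, cnst \<alpha>\<^sub>2 * (cnst \<alpha>\<^sub>1 + cnst \<alpha>\<^sub>2):]:]"
    by (simp add: CC_def xx_def cnst_simps)
  have "H_VI \<alpha>\<^sub>0 \<alpha>\<^sub>1 \<alpha>\<^sub>2 \<alpha>\<^sub>3 \<alpha>\<^sub>4 = CC h * [:[:0, cnst \<alpha>\<^sub>2 * (cnst \<alpha>\<^sub>1 + cnst \<alpha>\<^sub>2):],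
      - [:b4 * tt, - (b0 + b3 * tt + b4 * (1 + tt)), b0 + b3 + b4:], [:0, tt, - (1 + tt), 1:]:]"
    unfolding H_VI_def h_def[symmetric] b3_def[symmetric] b4_def[symmetric] y2 y1 y0 by simp
  then show ?thesis
    unfolding hamiltonian_system_def part_x_def part_y_def CCx
    by (simp add: pderiv_pCons map_poly_pCons mult.assoc del: minus_add_distrib)
qed


section \<open>The scheme determines the coefficients\<close>

lemma quadratic_with_three_roots:
  fixes t :: "'a::field"
  assumes "t \<noteq> 0" "t \<noteq> 1" "\<And>x. x \<in> {0, 1, t} \<Longrightarrow> poly [:a, b, c:] x = 0"
  shows "a = 0 \<and> b = 0 \<and> c = 0"
proof -
  have "card {0, 1, t} = 3" using assms(1,2) by auto
  then have "[:a, b, c:] = 0"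
    using assms(3) by (intro poly_eqI_degree[of "{0, 1, t}"]) auto
  then show ?thesis by simp
qed

text \<open>The polynomials \<open>P - 2 f3 x (x - 1) (x - t)\<close> and \<open>R + P'/2\<close> are quadratic with the roots
  \<open>0, 1, t\<close>.  Eliminating \<open>q0\<close> and \<open>q1\<close> from the three values of \<open>Q\<close> leaves
  \<open>f3 t (t - 1) (\<beta>0 + \<beta>1 + 2 A + \<beta>3 + \<beta>4) = 1\<close>, which fixes the scaling.\<close>

lemma coefficients_from_scheme:
  fixes t A :: "'a::field"
  assumes t: "t \<noteq> 0" "t \<noteq> 1" and two: "(2::'a) \<noteq> 0"
    and rel: "\<beta>0 + \<beta>1 + 2 * A + \<beta>3 + \<beta>4 = 1"
    and P: "P = [:p0, p1, p2, p3:]" and Q: "Q = [:q0, q1, q2:]" and R: "R = [:r0, r1, r2:]"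
    and at0: "poly P 0 = 0" "poly (pderiv P) 0 = 2 * f0" "poly Q 0 = - f0 * \<beta>4" "poly R 0 = - f0"
    and at1: "poly P 1 = 0" "poly (pderiv P) 1 = 2 * f1" "poly Q 1 = - f1 * \<beta>3" "poly R 1 = - f1"
    and att: "poly P t = 0" "poly (pderiv P) t = 2 * f2" "poly Q t - 1 = - f2 * \<beta>0" "poly R t = - f2"
    and ati: "p3 = 2 * f3" "A * p3 - q2 = - f3 * \<beta>1"
  defines "h \<equiv> 1 / (t * (t - 1))"
  shows "p0 = 0" "p1 = 2 * h * t" "p2 = - 2 * h * (1 + t)" "p3 = 2 * h"
    "r0 = - h * t" "r1 = 2 * h * (1 + t)" "r2 = - 3 * h"
    "q0 = - h * \<beta>4 * t" "q1 = h * ((\<beta>0 - 1) + \<beta>3 * t + \<beta>4 * (1 + t))" "q2 = h * (\<beta>1 + 2 * A)"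
proof -
  have "p0 = 0 \<and> p1 - 2 * f3 * t = 0 \<and> p2 + 2 * f3 * (1 + t) = 0"
  proof (rule quadratic_with_three_roots[OF t])
    show "poly [:p0, p1 - 2 * f3 * t, p2 + 2 * f3 * (1 + t):] x = 0" if "x \<in> {0, 1, t}" for x
    proof -
      have "poly P x = 0" using that at0 at1 att by auto
      moreover have "x * (x - 1) * (x - t) = 0" using that by auto
      moreover have "poly [:p0, p1 - 2 * f3 * t, p2 + 2 * f3 * (1 + t):] x =
          poly P x - 2 * f3 * (x * (x - 1) * (x - t))"
        by (simp add: P ati algebra_simps)
      ultimately show ?thesis by simp
    qed
  qed
  then have p: "p0 = 0" "p1 = 2 * f3 * t" "p2 = - 2 * f3 * (1 + t)" by (simp_all add: eq_neg_iff_add_eq_0)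
  have dP: "poly (pderiv P) x = p1 + 2 * p2 * x + 3 * p3 * x^2" for x
    by (simp add: P pderiv_pCons algebra_simps power2_eq_square)
  have "2 * f0 = 2 * (f3 * t)" "2 * f1 = 2 * (f3 * (1 - t))" "2 * f2 = 2 * (f3 * t * (t - 1))"
    unfolding at0(2)[symmetric] at1(2)[symmetric] att(2)[symmetric] dP p ati(1)
    by (simp_all add: algebra_simps power2_eq_square)
  then have f: "f0 = f3 * t" "f1 = f3 * (1 - t)" "f2 = f3 * t * (t - 1)" using two by simp_all
  have "r0 + f3 * t = 0 \<and> r1 - 2 * f3 * (1 + t) = 0 \<and> r2 + 3 * f3 = 0"
  proof (rule quadratic_with_three_roots[OF t])
    show "poly [:r0 + f3 * t, r1 - 2 * f3 * (1 + t), r2 + 3 * f3:] x = 0" if "x \<in> {0, 1, t}" for x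
      using that at0(4) at1(4) att(4) by (auto simp: R f algebra_simps)
  qed
  then have r: "r0 = - f3 * t" "r1 = 2 * f3 * (1 + t)" "r2 = - 3 * f3" by (simp_all add: eq_neg_iff_add_eq_0)
  have "q2 = A * p3 + f3 * \<beta>1" using ati(2) by (simp add: algebra_simps)
  also have "\<dots> = f3 * (\<beta>1 + 2 * A)" unfolding ati(1) by (simp add: algebra_simps)
  finally have q2: "q2 = f3 * (\<beta>1 + 2 * A)" .
  have q0: "q0 = - f3 * \<beta>4 * t" using at0(3) by (simp add: Q f)
  have q1: "q1 = - f1 * \<beta>3 - q0 - q2" using at1(3) by (simp add: Q algebra_simps)
  have "1 = q0 + q1 * t + q2 * t^2 + f2 * \<beta>0" using att(3) by (simp add: Q algebra_simps power2_eq_square)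
  also have "\<dots> = f3 * (t * (t - 1)) * (\<beta>0 + \<beta>1 + 2 * A + \<beta>3 + \<beta>4)"
    unfolding q1 q0 q2 f by (simp add: algebra_simps power2_eq_square)
  finally have h: "f3 * (t * (t - 1)) = 1" by (simp add: rel)
  then have "h = f3" using t by (simp add: h_def divide_simps)
  then show "p0 = 0" "p1 = 2 * h * t" "p2 = - 2 * h * (1 + t)" "p3 = 2 * h"
    "r0 = - h * t" "r1 = 2 * h * (1 + t)" "r2 = - 3 * h"
    "q0 = - h * \<beta>4 * t" "q2 = h * (\<beta>1 + 2 * A)"
    using p r q0 q2 ati by simp_all
  have s: "\<beta>1 + 2 * A = 1 - \<beta>0 - \<beta>3 - \<beta>4" unfolding rel[symmetric] by simp
  show "q1 = h * ((\<beta>0 - 1) + \<beta>3 * t + \<beta>4 * (1 + t))"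
    unfolding q1 q0 q2 f \<open>h = f3\<close> s by (simp add: algebra_simps)
qed

section \<open>Characterization of Painleve VI by its scheme\<close>

theorem theorem3p2:
  fixes \<alpha>\<^sub>0 \<alpha>\<^sub>1 \<alpha>\<^sub>2 \<alpha>\<^sub>3 \<alpha>\<^sub>4 :: complex
    and a :: "nat \<Rightarrow> ratfun"
    and f\<^sub>0 f\<^sub>1 f\<^sub>2 f\<^sub>3 :: ratfun
  assumes "\<alpha>\<^sub>0 + \<alpha>\<^sub>1 + 2 * \<alpha>\<^sub>2 + \<alpha>\<^sub>3 + \<alpha>\<^sub>4 = 1"
    and "has_painleve_scheme \<alpha>\<^sub>2 (system_S \<alpha>\<^sub>2 a)
      [(Finite 0,  f\<^sub>0 \<cdot>\<^sub>m mat_of_rows_list 2 [[2, - cnst \<alpha>\<^sub>4], [0, 1]]),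
       (Finite 1,  f\<^sub>1 \<cdot>\<^sub>m mat_of_rows_list 2 [[2, - cnst \<alpha>\<^sub>3], [0, 1]]),
       (Finite tt, f\<^sub>2 \<cdot>\<^sub>m mat_of_rows_list 2 [[2, - cnst \<alpha>\<^sub>0], [0, 1]]),
       (Infinity,  f\<^sub>3 \<cdot>\<^sub>m mat_of_rows_list 2 [[2, - cnst \<alpha>\<^sub>1], [0, 1]])]"
  shows "system_S \<alpha>\<^sub>2 a = hamiltonian_system (H_VI \<alpha>\<^sub>0 \<alpha>\<^sub>1 \<alpha>\<^sub>2 \<alpha>\<^sub>3 \<alpha>\<^sub>4)"
proof -
  let ?A = "cnst \<alpha>\<^sub>2"
  define q1 q2 where "q1 = (a 2 + a 9) * ?A - a 6" and "q2 = 1/2 * ((3 * a 1 + 2 * a 3) * ?A - a 4)"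
  (* The system (S) as dx/dt = P y + Q, dy/dt = R y^2 + S y + E. *)
  define P Q R where "P = [:a 7, a 5, a 2, a 1:]" and "Q = [:a 8, q1, q2:]" and "R = [:a 10, a 9, a 3:]"
  define E S where "E = [:1/2 * (a 1 * ?A + a 4) * ?A:]" and "S = [:a 6, a 4:]"
  note defs = P_def Q_def R_def E_def S_def q1_def q2_def
  have sys: "system_S \<alpha>\<^sub>2 a = ([:Q, P:], [:E, S, R:])"
    unfolding defs by (rule system_S_eq)
  let ?M = "\<lambda>f \<alpha>. f \<cdot>\<^sub>m mat_of_rows_list 2 [[2, - cnst \<alpha>], [0, 1]]"
  have lin: "linear_approximation \<alpha>\<^sub>2 ([:Q, P:], [:E, S, R:]) (Finite 0) (?M f\<^sub>0 \<alpha>\<^sub>4)"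
    "linear_approximation \<alpha>\<^sub>2 ([:Q, P:], [:E, S, R:]) (Finite 1) (?M f\<^sub>1 \<alpha>\<^sub>3)"
    "linear_approximation \<alpha>\<^sub>2 ([:Q, P:], [:E, S, R:]) (Finite tt) (?M f\<^sub>2 \<alpha>\<^sub>0)"
    "linear_approximation \<alpha>\<^sub>2 ([:Q, P:], [:E, S, R:]) Infinity (?M f\<^sub>3 \<alpha>\<^sub>1)"
    using assms(2) unfolding has_painleve_scheme_def sys by simp_all
  have M: "?M f \<alpha> $$ (0,0) = 2 * f" "?M f \<alpha> $$ (0,1) = - f * cnst \<alpha>" "?M f \<alpha> $$ (1,1) = f" for f \<alpha>
    by (simp_all add: mat_of_rows_list_def)
  have d: "ddt 0 = 0" "ddt 1 = 0" using ddt_cnst[of 0] ddt_cnst[of 1] by (simp_all add: cnst_simps)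
  have "cnst (\<alpha>\<^sub>0 + \<alpha>\<^sub>1 + 2 * \<alpha>\<^sub>2 + \<alpha>\<^sub>3 + \<alpha>\<^sub>4) = 1" unfolding assms(1) by (rule cnst_simps)
  then have rel: "cnst \<alpha>\<^sub>0 + cnst \<alpha>\<^sub>1 + 2 * ?A + cnst \<alpha>\<^sub>3 + cnst \<alpha>\<^sub>4 = 1"
    by (simp add: cnst_simps)
  note fin = linear_approximation_finite[OF lin(1)] linear_approximation_finite[OF lin(2)]
    linear_approximation_finite[OF lin(3)]
  note inf = linear_approximation_infinity[OF lin(4)[unfolded P_def Q_def]]
  note sol = coefficients_from_scheme[OF tt_nz two_nz rel P_def Q_def R_def,
      of f\<^sub>0 f\<^sub>1 f\<^sub>2 f\<^sub>3, OF fin[unfolded M d ddt_tt diff_0_right minus_minus] inf[unfolded M]]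
  define h where "h = 1 / (tt * (tt - 1))"
  note sol = sol[folded h_def]
  (* The leading coefficient of Q, found at infinity, against the one read off from H_VI. *)
  have sum: "cnst \<alpha>\<^sub>0 - 1 + cnst \<alpha>\<^sub>3 + cnst \<alpha>\<^sub>4 = - (cnst \<alpha>\<^sub>1 + 2 * ?A)"
    unfolding rel[symmetric] by simp
  (* S and E: since 3 a1 + 2 a3 = 0 and a2 + a9 = 0, the coefficients a4 and a6 are those of
     -dQ/dx. *)
  have "2 * q2 = (3 * a 1 + 2 * a 3) * ?A - a 4" using two_nz by (simp add: q2_def)
  then have "a 4 = (3 * a 1 + 2 * a 3) * ?A - 2 * q2" by simp
  then have a4: "a 4 = - 2 * h * (cnst \<alpha>\<^sub>1 + 2 * ?A)" unfolding sol by (simp add: algebra_simps)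
  have "a 6 = (a 2 + a 9) * ?A - q1" by (simp add: q1_def)
  then have a6: "a 6 = - q1" unfolding sol by simp
  have "a 1 * ?A + a 4 = 2 * (- h * (cnst \<alpha>\<^sub>1 + ?A))" unfolding sol a4 by (simp add: algebra_simps)
  then have E: "1/2 * (a 1 * ?A + a 4) * ?A = - h * ?A * (cnst \<alpha>\<^sub>1 + ?A)" using two_nz by simp
  show ?thesis
    unfolding sys hamiltonian_system_H_VI_eq P_def Q_def R_def E_def S_def E h_def[symmetric] sum
    unfolding a6 a4 sol by (simp add: algebra_simps)
qed

end
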